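(* For every integer $n\geq 3$, writing $f_q(n)$ for the total number of occurrences of the pattern $q$ in all permutations of $S_n(123,132,231)$, we have $$f_{213}(n)=f_{312}(n)=\binom{n}{3},\qquad f_{321}(n)=(n-2)\binom{n}{3}.$$
   Context: $S_n$ is the set of permutations of $\{1,\dots,n\}$ written in one-line notation $\sigma=\sigma_1\sigma_2\cdots\sigma_n$. For $q\in S_k$, an occurrence of the pattern $q$ in $\sigma\in S_n$ is a choice of indices $i_1<i_2<\cdots<i_k$ in $\{1,\dots,n\}$ such that for all $1\le j,l\le k$, $q_j<q_l$ if and only if $\sigma_{i_j}<\sigma_{i_l}$. Let $f_q(\sigma)$ be the number of occurrences of $q$ in $\sigma$; $\sigma$ avoids $q$ if $f_q(\sigma)=0$. $S_n(123,132,231)$ is the set of permutations in $S_n$ avoiding all of $123$, $132$ and $231$, and $f_q(n)=\sum_{\sigma\in S_n(123,132,231)}f_q(\sigma)$. *)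

theory Defs
  imports Main "HOL-Combinatorics.Multiset_Permutations"
begin

text \<open>A permutation of \<open>{1, \<dots>, n}\<close> is its one-line notation, a list; the pattern 213 is
  \<open>[2, 1, 3]\<close>. Positions are list positions and so are counted from 0.\<close>

definition S :: "nat \<Rightarrow> nat list set" where
  "S n = permutations_of_set {1..n}"

text \<open>An occurrence \<open>i\<^sub>1 < \<dots> < i\<^sub>k\<close> is the strictly increasing list of its indices.\<close>

definition occurrences :: "nat list \<Rightarrow> nat list \<Rightarrow> nat list set" where
  "occurrences q \<sigma> = {is. length is = length q \<and> sorted_wrt (<) is \<and> set is \<subseteq> {0..<length \<sigma>} \<and>
     (\<forall>j<length q. \<forall>l<length q. q ! j < q ! l \<longleftrightarrow> \<sigma> ! (is ! j) < \<sigma> ! (is ! l))}"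

definition occ_count :: "nat list \<Rightarrow> nat list \<Rightarrow> nat" where
  "occ_count q \<sigma> = card (occurrences q \<sigma>)"

definition avoids :: "nat list \<Rightarrow> nat list \<Rightarrow> bool" where
  "avoids \<sigma> q \<longleftrightarrow> occ_count q \<sigma> = 0"

definition S_avoiding :: "nat \<Rightarrow> nat list set \<Rightarrow> nat list set" where
  "S_avoiding n Q = {\<sigma> \<in> S n. \<forall>q\<in>Q. avoids \<sigma> q}"

definition total_occ :: "nat list \<Rightarrow> nat \<Rightarrow> nat" where
  "total_occ q n = (\<Sum>\<sigma>\<in>S_avoiding n {[1,2,3], [1,3,2], [2,3,1]}. occ_count q \<sigma>)"

end

theory Submission
  imports Defs "HOL-Library.Ramsey"
begin

text \<open>In a permutation avoiding 123, 132 and 231 an ascent can only end at the last position, so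
  such a permutation is determined by its last entry \<open>k\<close>: the other entries decrease. The three
  entries with values in a set \<open>A\<close> then form 213, 312 or 321 according to the position of \<open>k\<close>
  relative to \<open>A\<close>: \<open>k\<close> is the maximum of \<open>A\<close>, the median of \<open>A\<close>, or the minimum of \<open>A\<close> or
  outside \<open>A\<close>. Hence every 3-subset \<open>A\<close> contributes \<open>1\<close>, \<open>1\<close> and \<open>1 + (n - 3)\<close> to the respective
  totals.\<close>

section \<open>Occurrences of patterns of length three and their value sets\<close>

text \<open>The order condition runs over nine pairs of positions in the pattern; the diagonal ones
  hold trivially, which leaves six comparisons. With the quantifiers gone, each concrete pattern
  becomes a case check on three entries.\<close>

lemma occurrences_3:
  "occurrences [p, q, r] \<sigma> = {[a, b, c] | a b c. a < b \<and> b < c \<and> c < length \<sigma> \<and>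
     (p < q \<longleftrightarrow> \<sigma> ! a < \<sigma> ! b) \<and> (q < p \<longleftrightarrow> \<sigma> ! b < \<sigma> ! a) \<and>
     (p < r \<longleftrightarrow> \<sigma> ! a < \<sigma> ! c) \<and> (r < p \<longleftrightarrow> \<sigma> ! c < \<sigma> ! a) \<and>
     (q < r \<longleftrightarrow> \<sigma> ! b < \<sigma> ! c) \<and> (r < q \<longleftrightarrow> \<sigma> ! c < \<sigma> ! b)}"
  (is "_ = ?R")
proof -
  have iff: "[a, b, c] \<in> occurrences [p, q, r] \<sigma> \<longleftrightarrow> [a, b, c] \<in> ?R" for a b c
  proof -
    have "sorted_wrt (<) [a, b, c] \<and> set [a, b, c] \<subseteq> {0..<length \<sigma>} \<longleftrightarrow>
        a < b \<and> b < c \<and> c < length \<sigma>"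
      by auto
    moreover have "(\<forall>j<length [p, q, r]. \<forall>l<length [p, q, r]. P j l) \<longleftrightarrow>
        P 0 0 \<and> P 0 1 \<and> P 0 2 \<and> P 1 0 \<and> P 1 1 \<and> P 1 2 \<and> P 2 0 \<and> P 2 1 \<and> P 2 2" for P
      by (simp add: All_less_Suc numeral_2_eq_2) metis
    ultimately show ?thesis
      unfolding occurrences_def by simp metis
  qed
  show ?thesis
  proof (rule set_eqI)
    fix xs
    show "xs \<in> occurrences [p, q, r] \<sigma> \<longleftrightarrow> xs \<in> ?R"
    proof (cases "\<exists>a b c. xs = [a, b, c]")
      case True
      then obtain a b c where "xs = [a, b, c]"
        by blast
      then show ?thesis
        by (simp only: iff)
    next
      case False
      then have "length xs \<noteq> 3"
        by (auto simp: numeral_3_eq_3 length_Suc_conv)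
      then show ?thesis
        using False by (auto simp: occurrences_def)
    qed
  qed
qed

lemma finite_occurrences: "finite (occurrences q \<sigma>)"
proof (rule finite_subset)
  show "occurrences q \<sigma> \<subseteq> {is. set is \<subseteq> {0..<length \<sigma>} \<and> length is = length q}"
    by (auto simp: occurrences_def)
qed (simp add: finite_lists_length_eq)

lemma avoids_iff: "avoids \<sigma> q \<longleftrightarrow> occurrences q \<sigma> = {}"
  by (simp add: avoids_def occ_count_def finite_occurrences)

text \<open>Distinct entries let the values of an occurrence determine its index set, and a strictly
  increasing list is determined by its set. Occurrences can therefore be counted as subsets of
  \<open>{1..n}\<close>, which do not depend on the permutation.\<close>

lemma occ_count_eq_card_value_sets:
  assumes "distinct \<sigma>"
  shows "occ_count q \<sigma> = card ((\<lambda>is. (!) \<sigma> ` set is) ` occurrences q \<sigma>)"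
  unfolding occ_count_def
proof (rule card_image[symmetric], rule inj_onI)
  fix xs ys assume xs: "xs \<in> occurrences q \<sigma>" and ys: "ys \<in> occurrences q \<sigma>"
    and eq: "(!) \<sigma> ` set xs = (!) \<sigma> ` set ys"
  have "inj_on ((!) \<sigma>) {0..<length \<sigma>}"
    using assms by (simp add: inj_on_nth)
  moreover have "set xs \<subseteq> {0..<length \<sigma>}" "set ys \<subseteq> {0..<length \<sigma>}"
    using xs ys by (auto simp: occurrences_def)
  ultimately have "set xs = set ys"
    using eq by (meson inj_on_image_eq_iff)
  then show "xs = ys"
    using xs ys by (auto simp: occurrences_def intro: strict_sorted_equal)
qed

section \<open>Permutations that decrease up to a prescribed last entry\<close>

definition decreasing_then :: "nat \<Rightarrow> nat \<Rightarrow> nat list" where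
  "decreasing_then n k = rev (sorted_list_of_set ({1..n} - {k})) @ [k]"

context
  fixes n k :: nat
  assumes k: "k \<in> {1..n}"
begin

lemma set_decreasing_then: "set (decreasing_then n k) = {1..n}"
  using k by (auto simp: decreasing_then_def)

lemma distinct_decreasing_then: "distinct (decreasing_then n k)"
  by (simp add: decreasing_then_def)

lemma length_decreasing_then: "length (decreasing_then n k) = n"
  using distinct_card[OF distinct_decreasing_then] by (simp add: set_decreasing_then)

lemma nth_decreasing_then_less:
  assumes "a < b" "b < n - 1"
  shows "decreasing_then n k ! b < decreasing_then n k ! a"
proof -
  let ?xs = "rev (sorted_list_of_set ({1..n} - {k}))"
  have "sorted_wrt (>) ?xs"
    by (simp add: sorted_wrt_rev)
  moreover have len: "length ?xs = n - 1"
    using k by simp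
  ultimately have "?xs ! b < ?xs ! a"
    using assms sorted_wrt_nth_less[of "(>)" ?xs a b] by simp
  then show ?thesis
    using assms len by (simp del: length_rev add: decreasing_then_def nth_append_left)
qed

lemma nth_decreasing_then_last: "decreasing_then n k ! (n - 1) = k"
  using k by (simp add: decreasing_then_def nth_append)

section \<open>Counting occurrences by 3-subsets of values\<close>

text \<open>Indexing is a bijection from the positions to \<open>{1..n}\<close>, so \<open>A\<close>
  pulls back to a set of three positions; sorting that set gives the triple.\<close>

lemma ex_increasing_triple:
  assumes "A \<in> nsets {1..n} 3"
  obtains a b c where "a < b" "b < c" "c < n" "A = (!) (decreasing_then n k) ` set [a, b, c]"
proof -
  let ?\<sigma> = "decreasing_then n k"
  have "A \<subseteq> (!) ?\<sigma> ` {0..<n}"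
    using assms set_decreasing_then length_decreasing_then nth_image[of n ?\<sigma>]
    by (simp add: nsets_def lessThan_atLeast0)
  then obtain I where I: "I \<subseteq> {0..<n}" "A = (!) ?\<sigma> ` I"
    by (auto simp: subset_image_iff)
  moreover have "inj_on ((!) ?\<sigma>) I"
    using I(1) by (auto intro!: inj_on_nth simp: distinct_decreasing_then length_decreasing_then)
  ultimately have "card I = 3"
    using assms by (simp add: nsets_def card_image)
  define xs where "xs = sorted_list_of_set I"
  have "finite I"
    using I(1) finite_subset by blast
  then have xs: "length xs = 3" "sorted_wrt (<) xs" "set xs = I"
    by (simp_all add: xs_def \<open>card I = 3\<close>)
  then obtain a b c where "xs = [a, b, c]"
    by (auto simp: numeral_3_eq_3 length_Suc_conv)
  then show thesis
    using that[of a b c] xs I by auto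
qed

text \<open>Position triples correspond bijectively to 3-subsets of values. Once a criterion
  \<open>P\<close> on the values decides whether a triple is an occurrence, counting occurrences
  means counting the 3-subsets that satisfy \<open>P\<close>.\<close>

lemma occ_count_decreasing_then:
  assumes "\<And>a b c. a < b \<Longrightarrow> b < c \<Longrightarrow> c < n \<Longrightarrow>
    [a, b, c] \<in> occurrences [p, q, r] (decreasing_then n k) \<longleftrightarrow>
      P ((!) (decreasing_then n k) ` set [a, b, c])"
  shows "occ_count [p, q, r] (decreasing_then n k) = card {A \<in> nsets {1..n} 3. P A}"
proof -
  let ?\<sigma> = "decreasing_then n k" and ?O = "occurrences [p, q, r] (decreasing_then n k)"
  have "(\<lambda>is. (!) ?\<sigma> ` set is) ` ?O = {A \<in> nsets {1..n} 3. P A}"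
  proof (intro equalityI subsetI)
    fix A assume "A \<in> (\<lambda>is. (!) ?\<sigma> ` set is) ` ?O"
    then obtain xs where xs: "xs \<in> ?O" "A = (!) ?\<sigma> ` set xs"
      by auto
    then obtain a b c where abc: "xs = [a, b, c]" "a < b" "b < c" "c < n"
      by (auto simp: occurrences_3 length_decreasing_then)
    have "card A = card (set xs)"
      unfolding xs(2) using abc
      by (intro card_image inj_on_nth) (auto simp: distinct_decreasing_then length_decreasing_then)
    moreover have "A \<subseteq> set ?\<sigma>"
      using xs abc by (auto simp: length_decreasing_then)
    ultimately show "A \<in> {A \<in> nsets {1..n} 3. P A}"
      using assms[of a b c] xs abc by (auto simp: nsets_def set_decreasing_then)
  next
    fix A assume A: "A \<in> {A \<in> nsets {1..n} 3. P A}"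
    then have "A \<in> nsets {1..n} 3"
      by simp
    then obtain a b c where "a < b" "b < c" "c < n" "A = (!) ?\<sigma> ` set [a, b, c]"
      by (rule ex_increasing_triple)
    moreover from this have "[a, b, c] \<in> ?O"
      using assms A by simp
    ultimately show "A \<in> (\<lambda>is. (!) ?\<sigma> ` set is) ` ?O"
      by (intro image_eqI)
  qed
  then show ?thesis
    by (simp only: occ_count_eq_card_value_sets[OF distinct_decreasing_then])
qed

text \<open>Only the third position can be the last one. If it is, \<open>z = k\<close> and its
  order relative to \<open>x\<close> and \<open>y\<close> is open; otherwise all three entries lie
  in the decreasing part and miss \<open>k\<close>. Each pattern is decided by these two
  cases.\<close>

lemma triple_in_decreasing_then:
  assumes "a < b" "b < c" "c < n"
  obtains x y z where "decreasing_then n k ! a = x" "decreasing_then n k ! b = y"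
    "decreasing_then n k ! c = z" "y < x" "z = k \<and> x \<noteq> k \<and> y \<noteq> k \<or> z < y \<and> k \<notin> {x, y, z}"
proof -
  let ?\<sigma> = "decreasing_then n k"
  \<comment> \<open>The entries are distinct, so \<open>k\<close> occurs only at the last
    position.\<close>
  have ne: "?\<sigma> ! i = k \<longleftrightarrow> i = n - 1" if "i < n" for i
  proof -
    have "?\<sigma> ! i = ?\<sigma> ! (n - 1) \<longleftrightarrow> i = n - 1"
      using that by (intro nth_eq_iff_index_eq distinct_decreasing_then)
        (use that in \<open>auto simp: length_decreasing_then\<close>)
    then show ?thesis
      by (simp only: nth_decreasing_then_last)
  qed
  show thesis
  proof (rule that[OF refl refl refl])
    show "?\<sigma> ! b < ?\<sigma> ! a"
      using assms by (intro nth_decreasing_then_less) auto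
    have "?\<sigma> ! c < ?\<sigma> ! b" if "c \<noteq> n - 1"
      using that assms by (intro nth_decreasing_then_less) auto
    moreover have "?\<sigma> ! a \<noteq> k" "?\<sigma> ! b \<noteq> k" "?\<sigma> ! c = k \<longleftrightarrow> c = n - 1"
      using ne assms by simp_all
    ultimately show "?\<sigma> ! c = k \<and> ?\<sigma> ! a \<noteq> k \<and> ?\<sigma> ! b \<noteq> k \<or>
        ?\<sigma> ! c < ?\<sigma> ! b \<and> k \<notin> {?\<sigma> ! a, ?\<sigma> ! b, ?\<sigma> ! c}"
      by (cases "c = n - 1") simp_all
  qed
qed

text \<open>The pattern needs \<open>x < z\<close>, which a decreasing triple violates. So
  \<open>z = k\<close> and \<open>k\<close> is the largest value; conversely,
  \<open>k = Max A\<close> puts \<open>k\<close> into \<open>A\<close>, hence at the end of the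
  triple.\<close>

lemma occ_count_213:
  "occ_count [2, 1, 3] (decreasing_then n k) = card {A \<in> nsets {1..n} 3. k = Max A}"
proof (rule occ_count_decreasing_then)
  fix a b c assume "a < b" "b < c" "c < n"
  then show "[a, b, c] \<in> occurrences [2, 1, 3] (decreasing_then n k) \<longleftrightarrow>
      k = Max ((!) (decreasing_then n k) ` set [a, b, c])"
    by (rule triple_in_decreasing_then)
      (use \<open>a < b\<close> \<open>b < c\<close> \<open>c < n\<close> in
        \<open>auto simp: occurrences_3 length_decreasing_then max_def split: if_splits\<close>)
qed

text \<open>The pattern needs \<open>y < z < x\<close>, again impossible in a decreasing triple, so
  \<open>z = k\<close> is the median.\<close>

lemma occ_count_312:
  "occ_count [3, 1, 2] (decreasing_then n k) =
     card {A \<in> nsets {1..n} 3. k \<in> A \<and> k \<noteq> Max A \<and> k \<noteq> Min A}"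
proof (rule occ_count_decreasing_then)
  fix a b c assume "a < b" "b < c" "c < n"
  then show "[a, b, c] \<in> occurrences [3, 1, 2] (decreasing_then n k) \<longleftrightarrow>
      k \<in> (!) (decreasing_then n k) ` set [a, b, c] \<and>
      k \<noteq> Max ((!) (decreasing_then n k) ` set [a, b, c]) \<and>
      k \<noteq> Min ((!) (decreasing_then n k) ` set [a, b, c])"
    by (rule triple_in_decreasing_then)
      (use \<open>a < b\<close> \<open>b < c\<close> \<open>c < n\<close> in
        \<open>auto simp: occurrences_3 length_decreasing_then max_def min_def split: if_splits\<close>)
qed

text \<open>A triple that misses \<open>k\<close> always decreases; one that ends in
  \<open>k\<close> decreases exactly when \<open>k\<close> is its smallest value.\<close>

lemma occ_count_321:
  "occ_count [3, 2, 1] (decreasing_then n k) =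
     card {A \<in> nsets {1..n} 3. k \<notin> A \<or> k = Min A}"
proof (rule occ_count_decreasing_then)
  fix a b c assume "a < b" "b < c" "c < n"
  then show "[a, b, c] \<in> occurrences [3, 2, 1] (decreasing_then n k) \<longleftrightarrow>
      k \<notin> (!) (decreasing_then n k) ` set [a, b, c] \<or>
      k = Min ((!) (decreasing_then n k) ` set [a, b, c])"
    by (rule triple_in_decreasing_then)
      (use \<open>a < b\<close> \<open>b < c\<close> \<open>c < n\<close> in
        \<open>auto simp: occurrences_3 length_decreasing_then min_def split: if_splits\<close>)
qed

section \<open>Classification of the avoiding permutations\<close>

text \<open>All three forbidden patterns start with an ascent \<open>p < q\<close> followed by a
  further entry. An occurrence would thus have an ascent that ends before the last position, inside
  the decreasing part.\<close>

lemma decreasing_then_in_S_avoiding: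
  "decreasing_then n k \<in> S_avoiding n {[1,2,3], [1,3,2], [2,3,1]}"
proof -
  have "occurrences [p, q, r] (decreasing_then n k) = {}" if "p < q" for p q r
  proof -
    have "\<not> decreasing_then n k ! a < decreasing_then n k ! b" if "a < b" "b < c" "c < n" for a b c
    proof -
      have "decreasing_then n k ! b < decreasing_then n k ! a"
        using that by (intro nth_decreasing_then_less) auto
      then show ?thesis
        by simp
    qed
    then show ?thesis
      using \<open>p < q\<close> by (auto simp: occurrences_3 length_decreasing_then)
  qed
  then show ?thesis
    by (simp add: S_avoiding_def S_def permutations_of_set_def set_decreasing_then
        distinct_decreasing_then avoids_iff)
qed

end

text \<open>An ascent that ends before the last position forms a forbidden pattern with the last
  entry: 123, 132 or 231 according to whether that entry lies above, between or below the two
  entries of the ascent.\<close>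

lemma S_avoiding_decreasing:
  assumes "\<sigma> \<in> S_avoiding n {[1,2,3], [1,3,2], [2,3,1]}" "i < j" "j < n - 1"
  shows "\<sigma> ! j < \<sigma> ! i"
proof (rule ccontr)
  have \<sigma>: "distinct \<sigma>" "set \<sigma> = {1..n}"
    and avoids: "avoids \<sigma> [1,2,3]" "avoids \<sigma> [1,3,2]" "avoids \<sigma> [2,3,1]"
    using assms(1) by (auto simp: S_avoiding_def S_def permutations_of_set_def)
  have len: "length \<sigma> = n"
    using distinct_card[OF \<sigma>(1)] \<sigma>(2) by simp
  assume "\<not> \<sigma> ! j < \<sigma> ! i"
  moreover have "\<sigma> ! i \<noteq> \<sigma> ! j" "\<sigma> ! i \<noteq> \<sigma> ! (n - 1)" "\<sigma> ! j \<noteq> \<sigma> ! (n - 1)"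
    using assms(2,3) \<sigma>(1) len by (simp_all add: nth_eq_iff_index_eq)
  ultimately have "[i, j, n - 1] \<in> occurrences [1,2,3] \<sigma> \<union> occurrences [1,3,2] \<sigma> \<union>
      occurrences [2,3,1] \<sigma>"
    using assms(2,3) len by (auto simp: occurrences_3)
  then show False
    using avoids by (auto simp: avoids_iff)
qed

lemma S_avoiding_eq_decreasing_then:
  assumes "\<sigma> \<in> S_avoiding n {[1,2,3], [1,3,2], [2,3,1]}" "n > 0"
  shows "\<sigma> \<in> decreasing_then n ` {1..n}"
proof -
  have \<sigma>: "distinct \<sigma>" "set \<sigma> = {1..n}"
    using assms(1) by (auto simp: S_avoiding_def S_def permutations_of_set_def)
  have len: "length \<sigma> = n"
    using distinct_card[OF \<sigma>(1)] \<sigma>(2) by simp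
  with \<open>n > 0\<close> obtain xs k where xs: "\<sigma> = xs @ [k]"
    by (metis append_butlast_last_id length_greater_0_conv)
  have "sorted_wrt (>) xs"
    unfolding sorted_wrt_iff_nth_less
    using S_avoiding_decreasing[OF assms(1)] len by (force simp: xs nth_append)
  then have "sorted_wrt (<) (rev xs)"
    by (simp add: sorted_wrt_rev)
  moreover have "set (rev xs) = {1..n} - {k}"
    using \<sigma> by (auto simp: xs)
  \<comment> \<open>A finite set has only one strictly increasing enumeration, so the last entry
    fixes everything before it.\<close>
  ultimately have "sorted_list_of_set ({1..n} - {k}) = rev xs"
    by (metis strict_sorted_equal finite_Diff finite_atLeastAtMost
        sorted_list_of_set.set_sorted_key_list_of_set sorted_list_of_set.strict_sorted_key_list_of_set)
  then have "\<sigma> = decreasing_then n k"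
    by (simp add: decreasing_then_def xs)
  moreover have "k \<in> {1..n}"
    using \<sigma>(2) by (auto simp: xs)
  ultimately show ?thesis
    by blast
qed

section \<open>Double counting over last entries and 3-subsets\<close>

text \<open>The avoiding permutations are parametrized by their last entry, injectively since
  \<open>k\<close> can be read off the end of the list; \<open>n > 0\<close> ensures that there is a
  last entry.\<close>

lemma total_occ_eq_sum:
  assumes "n > 0"
  shows "total_occ q n = (\<Sum>k\<in>{1..n}. occ_count q (decreasing_then n k))"
proof -
  have "S_avoiding n {[1,2,3], [1,3,2], [2,3,1]} = decreasing_then n ` {1..n}"
    using S_avoiding_eq_decreasing_then[OF _ assms] decreasing_then_in_S_avoiding by blast
  moreover have "inj_on (decreasing_then n) {1..n}"
    by (auto simp: inj_on_def decreasing_then_def)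
  ultimately show ?thesis
    by (simp add: total_occ_def sum.reindex)
qed

text \<open>Both sides count the pairs \<open>(k, A)\<close> with \<open>P k A\<close>, the left one
  by \<open>k\<close> and the right one by \<open>A\<close>.\<close>

lemma sum_card_nsets:
  assumes "\<And>A. A \<in> nsets {1..n} 3 \<Longrightarrow> card {k \<in> {1..n}. P k A} = m"
  shows "(\<Sum>k\<in>{1..n}. card {A \<in> nsets {1..n} 3. P k A}) = m * (n choose 3)"
  using sum_multicount[of "{1..n}" "nsets {1..n} 3" P m] assms
  by (simp add: finite_imp_finite_nsets)

theorem theorem3p5:
  fixes n :: nat
  assumes "n \<ge> 3"
  shows "total_occ [2,1,3] n = n choose 3 \<and>
         total_occ [3,1,2] n = n choose 3 \<and>
         total_occ [3,2,1] n = (n - 2) * (n choose 3)"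
proof (intro conjI)
  have n: "n > 0"
    using assms by simp
  \<comment> \<open>Naming the elements in increasing order exhibits the minimum, median and maximum
    of \<open>A\<close>, so that the admissible \<open>k\<close> can be listed for each
    pattern.\<close>
  have three: "\<exists>x y z. x < y \<and> y < z \<and> A = {x, y, z} \<and> 1 \<le> x \<and> z \<le> n"
    if "A \<in> nsets {1..n} 3" for A
  proof -
    have A: "finite A" "card A = 3" "A \<subseteq> {1..n}"
      using that by (auto simp: nsets_def)
    define xs where "xs = sorted_list_of_set A"
    have xs: "length xs = 3" "sorted_wrt (<) xs" "set xs = A"
      using A by (simp_all add: xs_def)
    then obtain x y z where "xs = [x, y, z]"
      by (auto simp: numeral_3_eq_3 length_Suc_conv)
    then have "x < y" "y < z" "A = {x, y, z}"
      using xs by auto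
    then show ?thesis
      using A(3) by auto
  qed
  have "card {k \<in> {1..n}. k = Max A} = 1" if "A \<in> nsets {1..n} 3" for A
  proof -
    obtain x y z where "x < y" "y < z" "A = {x, y, z}" "1 \<le> x" "z \<le> n"
      using three[OF \<open>A \<in> nsets {1..n} 3\<close>] by blast
    then have "{k \<in> {1..n}. k = Max A} = {z}"
      by auto
    then show ?thesis
      by simp
  qed
  from sum_card_nsets[where P = "\<lambda>k A. k = Max A", OF this]
  show "total_occ [2,1,3] n = n choose 3"
    by (simp add: total_occ_eq_sum[OF n] occ_count_213 del: One_nat_def)
  have "card {k \<in> {1..n}. k \<in> A \<and> k \<noteq> Max A \<and> k \<noteq> Min A} = 1" if "A \<in> nsets {1..n} 3" for A
  proof -
    obtain x y z where "x < y" "y < z" "A = {x, y, z}" "1 \<le> x" "z \<le> n"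
      using three[OF \<open>A \<in> nsets {1..n} 3\<close>] by blast
    then have "{k \<in> {1..n}. k \<in> A \<and> k \<noteq> Max A \<and> k \<noteq> Min A} = {y}"
      by auto
    then show ?thesis
      by simp
  qed
  from sum_card_nsets[where P = "\<lambda>k A. k \<in> A \<and> k \<noteq> Max A \<and> k \<noteq> Min A", OF this]
  show "total_occ [3,1,2] n = n choose 3"
    by (simp add: total_occ_eq_sum[OF n] occ_count_312 del: One_nat_def)
  have "card {k \<in> {1..n}. k \<notin> A \<or> k = Min A} = n - 2" if "A \<in> nsets {1..n} 3" for A
  proof -
    obtain x y z where "x < y" "y < z" "A = {x, y, z}" "1 \<le> x" "z \<le> n"
      using three[OF \<open>A \<in> nsets {1..n} 3\<close>] by blast
    \<comment> \<open>Only the median and the maximum of \<open>A\<close> are excluded as last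
      entries, which is where the factor \<open>n - 2\<close> comes from.\<close>
    then have "{k \<in> {1..n}. k \<notin> A \<or> k = Min A} = {1..n} - {y, z}"
      by auto
    moreover have "{y, z} \<subseteq> {1..n}"
      using \<open>x < y\<close> \<open>y < z\<close> \<open>z \<le> n\<close> by auto
    ultimately show ?thesis
      using \<open>y < z\<close> by (simp add: card_Diff_subset)
  qed
  from sum_card_nsets[where P = "\<lambda>k A. k \<notin> A \<or> k = Min A", OF this]
  show "total_occ [3,2,1] n = (n - 2) * (n choose 3)"
    by (simp add: total_occ_eq_sum[OF n] occ_count_321 del: One_nat_def)
qed

end
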